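(* For $x$ a positive real number, as $x\to\infty$, $$\Gamma(x+1)\sim \sqrt{\pi}\left(\dfrac{x}{e}\right)^x\left(8x^3+4x^2+x+\dfrac{1-\dfrac{11}{8x}+\dfrac{79}{112x^2}+\dfrac{A}{x^3}}{30}\right)^{\frac{1}{6}},$$ where $A=\dfrac{380279456577}{722091376690}$.
   Context: Here $\Gamma$ is the Euler gamma function, and $x$ is a real variable. The notation $g(x)\sim h(x)$ (as $x\to\infty$) means that $g$ is asymptotic to $h$, i.e. $\lim_{x\to\infty} g(x)/h(x)=1$. *)

theory Defs
  imports "HOL-Analysis.Analysis" "HOL-Library.Landau_Symbols"
begin

end

theory Submission
  imports Defs "HOL-Real_Asymp.Real_Asymp"
begin

text \<open>
  As \<open>x\<close> grows, the sixth root is governed by the leading term of the polynomial: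
  \<open>(8 x\<^sup>3) powr (1/6) = sqrt (2 x)\<close>. The right-hand side is therefore asymptotic to
  \<open>sqrt (2 \<pi> x) (x/e)\<^sup>x\<close>, and the claim is Stirling's formula for a real argument.

  Stirling's formula amounts to \<open>\<sigma>(x) \<longlongrightarrow> ln (2 \<pi>) / 2\<close> for
  \<open>\<sigma>(x) = ln \<Gamma>(x) - (x - 1/2) ln x + x\<close>. The functional equation of \<open>\<Gamma>\<close> gives
  \<open>\<sigma>(x) - \<sigma>(x + 1) = (x + 1/2) ln (1 + 1/x) - 1\<close>, and the midpoint and trapezoid estimates for
  the integral of \<open>1/t\<close> from \<open>x\<close> to \<open>x + 1\<close> place this difference between \<open>0\<close> and
  the telescoping term \<open>1/(4x) - 1/(4(x + 1))\<close> (lemma \<open>stirling_log_step\<close>). So \<open>\<sigma>\<close> converges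
  along \<open>x, x + 1, x + 2, \<dots>\<close> to a limit within \<open>1/(4x)\<close> of \<open>\<sigma>(x)\<close>. Gauss's product for
  \<open>\<Gamma>\<close> shows that this limit does not depend on \<open>x\<close>
  (lemma \<open>stirling_log_shift_tendsto_0\<close>), hence \<open>\<sigma>\<close> converges as \<open>x\<close> tends to infinity
  through the reals. Legendre's duplication formula then evaluates the limit
  (lemma \<open>stirling_log_duplication\<close>).
\<close>

lemma pos_not_nonpos_Int: "(x::real) > 0 \<Longrightarrow> x \<notin> \<int>\<^sub>\<le>\<^sub>0"
  by (auto dest: nonpos_Ints_nonpos)

lemma Gamma_duplication_real:
  assumes "(x::real) > 0"
  shows "Gamma x * Gamma (x + 1 / 2) = exp ((1 - 2 * x) * ln 2) * sqrt pi * Gamma (2 * x)"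
proof -
  have "complex_of_real (Gamma x * Gamma (x + 1 / 2))
      = Gamma (complex_of_real x) * Gamma (complex_of_real x + 1 / 2)"
    using Gamma_complex_of_real[of "x + 1 / 2"] by (simp add: Gamma_complex_of_real)
  also have "\<dots> = exp ((1 - 2 * complex_of_real x) * of_real (ln 2)) * of_real (sqrt pi)
                    * Gamma (2 * complex_of_real x)"
  proof (rule Gamma_legendre_duplication)
    show "complex_of_real x \<notin> \<int>\<^sub>\<le>\<^sub>0"
      using assms pos_not_nonpos_Int[of x] by (simp add: of_real_in_nonpos_Ints_iff)
    have "complex_of_real (x + 1 / 2) \<notin> \<int>\<^sub>\<le>\<^sub>0"
      using assms pos_not_nonpos_Int[of "x + 1 / 2"] by (simp only: of_real_in_nonpos_Ints_iff) simp
    thus "complex_of_real x + 1 / 2 \<notin> \<int>\<^sub>\<le>\<^sub>0" by simp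
  qed
  also have "\<dots> = complex_of_real (exp ((1 - 2 * x) * ln 2) * sqrt pi * Gamma (2 * x))"
    using Gamma_complex_of_real[of "2 * x"] by (simp add: exp_of_real[symmetric])
  finally show ?thesis by (simp only: of_real_eq_iff)
qed

text \<open>
  The logarithm of \<open>\<Gamma>(x + 1) / (sqrt x (x/e)\<^sup>x)\<close> for \<open>x > 0\<close>, written \<open>\<sigma>(x)\<close> in the comments.
\<close>

definition stirling_log :: "real \<Rightarrow> real" where
  "stirling_log x = ln (Gamma x) - (x - 1 / 2) * ln x + x"

text \<open>
  With \<open>D = ln (x + 1) - ln x\<close>, the integral of \<open>1/t\<close> over \<open>[x, x + 1]\<close>, convexity of
  \<open>1/t\<close> bounds \<open>D\<close> below by the midpoint rule and above by the trapezoid rule. The factor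
  \<open>x + 1/2\<close> is the midpoint, so the lower bound is exactly what makes the decrease nonnegative.
\<close>

lemma stirling_log_step:
  assumes "x > 0"
  shows "stirling_log (x + 1) \<le> stirling_log x"
    and "stirling_log x - 1 / (4 * x) \<le> stirling_log (x + 1) - 1 / (4 * (x + 1))"
proof -
  define D where "D = ln (x + 1) - ln x"
  have "Gamma (x + 1) = x * Gamma x"
    using assms by (intro Gamma_plus1 pos_not_nonpos_Int)
  hence "ln (Gamma (x + 1)) = ln x + ln (Gamma x)"
    using assms by (simp add: ln_mult_pos)
  hence diff: "stirling_log x - stirling_log (x + 1) = (x + 1 / 2) * D - 1"
    by (simp add: stirling_log_def D_def algebra_simps)
  have "2 / (2 * x + 1) \<le> D"
    using ln_inverse_approx_ge[of x "x + 1"] assms by (simp add: D_def field_simps)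
  hence "1 \<le> (x + 1 / 2) * D"
    using assms by (simp add: field_simps)
  thus "stirling_log (x + 1) \<le> stirling_log x"
    using diff by simp
  have "D \<le> (inverse x + inverse (x + 1)) / 2"
    using ln_inverse_approx_le[of x 1] assms by (simp add: D_def)
  hence "(x + 1 / 2) * D \<le> (x + 1 / 2) * ((inverse x + inverse (x + 1)) / 2)"
    using assms by (intro mult_left_mono) auto
  also have "\<dots> = 1 + 1 / (4 * x) - 1 / (4 * (x + 1))"
    using assms by (simp add: divide_simps) (simp add: algebra_simps)
  finally show "stirling_log x - 1 / (4 * x) \<le> stirling_log (x + 1) - 1 / (4 * (x + 1))"
    using diff by simp
qed

lemma stirling_log_add_nat:
  assumes "x > 0"
  shows "stirling_log (x + real n) \<le> stirling_log x"
    and "stirling_log x - 1 / (4 * x) \<le> stirling_log (x + real n) - 1 / (4 * (x + real n))"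
proof (induction n)
  case (Suc n)
  have "x + real n > 0" using assms by simp
  from stirling_log_step[OF this] Suc
  show "stirling_log (x + real (Suc n)) \<le> stirling_log x"
    "stirling_log x - 1 / (4 * x)
       \<le> stirling_log (x + real (Suc n)) - 1 / (4 * (x + real (Suc n)))"
    by (simp_all only: of_nat_Suc add.assoc[symmetric] add.commute[of 1 "real n"])
qed auto

text \<open>
  Up to elementary terms in \<open>n\<close>, this is Gauss's limit \<open>\<Gamma>(x + n + 1) / (\<Gamma>(n + 1) n\<^sup>x) \<longlongrightarrow> 1\<close> in
  logarithmic form. It is what links a real argument to the integers.
\<close>

lemma stirling_log_shift_tendsto_0:
  assumes "x > 0"
  shows "(\<lambda>n. stirling_log (x + real n + 1) - stirling_log (real n + 1)) \<longlonglongrightarrow> 0"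
proof -
  \<comment> \<open>\<open>R n\<close> is Gauss's quotient \<open>\<Gamma>(x + n + 1) / (\<Gamma>(n + 1) n\<^sup>x)\<close>.\<close>
  define R where "R = (\<lambda>n. Gamma x / Gamma_series x n)"
  have xn: "x \<notin> \<int>\<^sub>\<le>\<^sub>0" using assms by (rule pos_not_nonpos_Int)
  have Gx: "Gamma x > 0" using assms by simp
  have "R \<longlonglongrightarrow> Gamma x / Gamma x"
    unfolding R_def using Gx by (intro tendsto_intros Gamma_series_LIMSEQ) auto
  hence "(\<lambda>n. ln (R n)) \<longlonglongrightarrow> ln 1"
    using Gx by (intro tendsto_ln) auto
  hence lim: "(\<lambda>n. ln (R n)) \<longlonglongrightarrow> 0" by simp
  have elem: "(\<lambda>n. x * ln (real n) - (x + real n + 1 / 2) * ln (x + real n + 1)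
          + (real n + 1 / 2) * ln (real n + 1) + x) \<longlonglongrightarrow> 0"
    by real_asymp
  have "eventually (\<lambda>n. ln (R n) + (x * ln (real n) - (x + real n + 1 / 2) * ln (x + real n + 1)
          + (real n + 1 / 2) * ln (real n + 1) + x)
        = stirling_log (x + real n + 1) - stirling_log (real n + 1)) sequentially"
    using eventually_gt_at_top[of 0]
  proof eventually_elim
    case (elim n)
    have "pochhammer x (n + 1) = Gamma (x + real n + 1) / Gamma x"
      using pochhammer_Gamma[OF xn, of "n + 1"] by (simp add: add_ac)
    moreover have "fact n = Gamma (real n + 1)"
      by (simp add: Gamma_fact add_ac)
    ultimately have "R n = Gamma (x + real n + 1) / (Gamma (real n + 1) * exp (x * ln (real n)))"
      using Gx by (simp add: R_def Gamma_series_def)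
    moreover have "Gamma (x + real n + 1) \<noteq> 0" "Gamma (real n + 1) \<noteq> 0"
      using assms by (simp_all add: less_imp_neq[symmetric])
    ultimately have "ln (R n) = ln (Gamma (x + real n + 1)) - ln (Gamma (real n + 1)) - x * ln (real n)"
      by (simp add: ln_div ln_mult)
    thus ?case by (simp add: stirling_log_def algebra_simps)
  qed
  with tendsto_add[OF lim elem] show ?thesis
    by (simp add: filterlim_cong)
qed

text \<open>
  The limit \<open>L\<close> is taken along the integers and transported to every sequence \<open>x + n + 1\<close>.
  Letting \<open>n\<close> grow in the bounds of \<open>stirling_log_add_nat\<close> gives
  \<open>L \<le> \<sigma>(x) \<le> L + 1/(4x)\<close>, an estimate uniform enough to let \<open>x\<close> itself tend to infinity.
\<close>

lemma stirling_log_convergent: "\<exists>L. (stirling_log \<longlongrightarrow> L) at_top"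
proof -
  have "decseq (\<lambda>n. stirling_log (real n + 1))"
    using stirling_log_step(1)[of "real n + 1" for n] by (intro decseq_SucI) (simp add: add_ac)
  moreover have "stirling_log 1 - 1 / 4 \<le> stirling_log (real n + 1)" for n
  proof -
    have "0 \<le> 1 / (4 * (1 + real n))" by simp
    hence "stirling_log 1 - 1 / 4 \<le> stirling_log (1 + real n)"
      using stirling_log_add_nat(2)[of 1 n] by linarith
    thus ?thesis by (simp add: add.commute)
  qed
  ultimately obtain L where L: "(\<lambda>n. stirling_log (real n + 1)) \<longlonglongrightarrow> L"
    by (metis decseq_convergent)
  have lim: "(\<lambda>n. stirling_log (x + real (n + 1))) \<longlonglongrightarrow> L" if "x > 0" for x
    using tendsto_add[OF stirling_log_shift_tendsto_0[OF that] L] by (simp add: add_ac)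
  have upper: "L \<le> stirling_log x" if "x > 0" for x
    by (rule LIMSEQ_le_const2[OF lim[OF that]]) (use stirling_log_add_nat(1)[OF that] in blast)
  have lower: "stirling_log x - 1 / (4 * x) \<le> L" if "x > 0" for x
  proof (rule LIMSEQ_le_const[OF lim[OF that]], intro exI allI impI)
    fix n
    have "0 \<le> 1 / (4 * (x + real (n + 1)))" using that by simp
    thus "stirling_log x - 1 / (4 * x) \<le> stirling_log (x + real (n + 1))"
      using stirling_log_add_nat(2)[OF that, of "n + 1"] by linarith
  qed
  have "(stirling_log \<longlongrightarrow> L) at_top"
  proof (rule tendsto_sandwich)
    show "eventually (\<lambda>x. L \<le> stirling_log x) at_top"
      using eventually_gt_at_top[of 0] by eventually_elim (rule upper)
    show "eventually (\<lambda>x. stirling_log x \<le> L + 1 / (4 * x)) at_top"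
      using eventually_gt_at_top[of 0] by eventually_elim (use lower in force)
    show "((\<lambda>x. L + 1 / (4 * x)) \<longlongrightarrow> L) at_top" by real_asymp
  qed simp
  thus ?thesis ..
qed

text \<open>
  Applied to a function converging to \<open>L\<close>, the combination on the left tends to
  \<open>L + L - L = L\<close>, while the right-hand side is elementary: this determines \<open>L\<close>.
\<close>

lemma stirling_log_duplication:
  assumes "x > 0"
  shows "stirling_log x + stirling_log (x + 1 / 2) - stirling_log (2 * x)
           = ln (2 * pi) / 2 + x * ln x - x * ln (x + 1 / 2) + 1 / 2"
proof -
  have pos: "Gamma x > 0" "Gamma (x + 1 / 2) > 0" "Gamma (2 * x) > 0"
    using assms by simp_all
  have "ln (Gamma x * Gamma (x + 1 / 2))
      = ln (exp ((1 - 2 * x) * ln 2) * sqrt pi * Gamma (2 * x))"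
    by (simp only: Gamma_duplication_real[OF assms])
  with pos have "ln (Gamma x) + ln (Gamma (x + 1 / 2))
      = (1 - 2 * x) * ln 2 + ln pi / 2 + ln (Gamma (2 * x))"
    by (simp add: ln_mult_pos ln_sqrt)
  with assms show ?thesis
    by (simp add: stirling_log_def ln_mult field_simps)
qed

theorem stirling_log_tendsto: "(stirling_log \<longlongrightarrow> ln (2 * pi) / 2) at_top"
proof -
  obtain L where L: "(stirling_log \<longlongrightarrow> L) at_top"
    using stirling_log_convergent by blast
  have half: "filterlim (\<lambda>x::real. x + 1 / 2) at_top at_top"
   and double: "filterlim (\<lambda>x::real. 2 * x) at_top at_top"
    by real_asymp+
  have "((\<lambda>x. stirling_log x + stirling_log (x + 1 / 2) - stirling_log (2 * x)) \<longlongrightarrow> L + L - L) at_top"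
    by (intro tendsto_intros L filterlim_compose[OF L half] filterlim_compose[OF L double])
  hence "((\<lambda>x. ln (2 * pi) / 2 + x * ln x - x * ln (x + 1 / 2) + 1 / 2) \<longlongrightarrow> L) at_top"
  proof (subst (asm) filterlim_cong[OF refl refl])
    show "eventually (\<lambda>x. stirling_log x + stirling_log (x + 1 / 2) - stirling_log (2 * x)
           = ln (2 * pi) / 2 + x * ln x - x * ln (x + 1 / 2) + 1 / 2) at_top"
      using eventually_gt_at_top[of 0] by eventually_elim (rule stirling_log_duplication)
  qed simp
  moreover have "((\<lambda>x. ln (2 * pi) / 2 + x * ln x - x * ln (x + 1 / 2) + 1 / 2)
                   \<longlongrightarrow> ln (2 * pi) / 2) at_top"
    by real_asymp
  ultimately have "L = ln (2 * pi) / 2"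
    by (rule tendsto_unique[rotated]) simp
  with L show ?thesis by simp
qed

theorem Gamma_stirling_asymp_equiv:
  "(\<lambda>x::real. Gamma (x + 1)) \<sim>[at_top] (\<lambda>x. sqrt (2 * pi * x) * (x / exp 1) powr x)"
proof (rule asymp_equivI')
  have "((\<lambda>x. exp (stirling_log x - ln (2 * pi) / 2)) \<longlongrightarrow> exp (ln (2 * pi) / 2 - ln (2 * pi) / 2)) at_top"
    by (intro tendsto_intros stirling_log_tendsto)
  hence "((\<lambda>x. exp (stirling_log x - ln (2 * pi) / 2)) \<longlongrightarrow> 1) at_top" by simp
  moreover have "eventually (\<lambda>x. exp (stirling_log x - ln (2 * pi) / 2)
      = Gamma (x + 1) / (sqrt (2 * pi * x) * (x / exp 1) powr x)) at_top"
    using eventually_gt_at_top[of 0]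
  proof eventually_elim
    case (elim x)
    have G: "Gamma x > 0" using elim by simp
    have "Gamma (x + 1) = exp (ln x + ln (Gamma x))"
      using elim G Gamma_plus1[OF pos_not_nonpos_Int[OF elim]] by (simp add: exp_add)
    moreover have "sqrt (2 * pi * x) = exp ((ln (2 * pi) + ln x) / 2)"
    proof -
      have "sqrt (2 * pi * x) = (2 * pi * x) powr (1 / 2)"
        using elim by (simp add: powr_half_sqrt)
      also have "\<dots> = exp (ln (2 * pi * x) / 2)"
        using elim by (simp add: powr_def)
      also have "ln (2 * pi * x) = ln (2 * pi) + ln x"
        using elim by (intro ln_mult_pos) auto
      finally show ?thesis .
    qed
    moreover have "(x / exp 1) powr x = exp (x * (ln x - 1))"
      using elim by (simp add: powr_def ln_div)
    ultimately show ?case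
      by (simp add: stirling_log_def field_simps flip: exp_add exp_diff)
  qed
  ultimately show "((\<lambda>x. Gamma (x + 1) / (sqrt (2 * pi * x) * (x / exp 1) powr x)) \<longlongrightarrow> 1) at_top"
    by (rule Lim_transform_eventually)
qed

theorem corollary2p3:
  fixes A :: real
  assumes "A = 380279456577 / 722091376690"
  shows "(\<lambda>x::real. Gamma (x + 1)) \<sim>[at_top]
         (\<lambda>x::real. sqrt pi * (x / exp 1) powr x *
            (8 * x ^ 3 + 4 * x ^ 2 + x
              + (1 - 11 / (8 * x) + 79 / (112 * x ^ 2) + A / x ^ 3) / 30) powr (1 / 6))"
proof -
  define p where "p = (\<lambda>x. 8 * x ^ 3 + 4 * x ^ 2 + x
      + (1 - 11 / (8 * x) + 79 / (112 * x ^ 2) + A / x ^ 3) / 30)"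
  have p_equiv: "p \<sim>[at_top] (\<lambda>x. 8 * x ^ 3)"
    unfolding p_def by (rule asymp_equivI') real_asymp
  have p_pos: "eventually (\<lambda>x. p x \<ge> 0) at_top"
    unfolding p_def by real_asymp
  have powr_equiv: "(\<lambda>x. p x powr (1 / 6)) \<sim>[at_top] (\<lambda>x. (8 * x ^ 3) powr (1 / 6))"
    by (intro asymp_equiv_powr_real p_equiv p_pos eventually_mono[OF eventually_ge_at_top[of 0]]) auto
  have leading: "eventually (\<lambda>x::real. sqrt (2 * x) = (8 * x ^ 3) powr (1 / 6)) at_top"
    using eventually_gt_at_top[of 0]
  proof eventually_elim
    case (elim x)
    have "8 * x ^ 3 = (2 * x) powr 3"
      using elim by (simp add: power_mult_distrib powr_numeral)
    hence "(8 * x ^ 3) powr (1 / 6) = (2 * x) powr (1 / 2)"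
      by (simp only: powr_powr) simp
    thus ?case using elim by (simp add: powr_half_sqrt)
  qed
  have root: "(\<lambda>x. sqrt (2 * x)) \<sim>[at_top] (\<lambda>x. p x powr (1 / 6))"
    by (rule asymp_equiv_trans[OF asymp_equiv_refl_ev[OF leading] asymp_equiv_symI[OF powr_equiv]])
  have "(\<lambda>x. (sqrt pi * (x / exp 1) powr x) * sqrt (2 * x))
      \<sim>[at_top] (\<lambda>x. (sqrt pi * (x / exp 1) powr x) * p x powr (1 / 6))"
    by (intro asymp_equiv_mult asymp_equiv_refl root)
  moreover have "(\<lambda>x::real. sqrt (2 * pi * x) * (x / exp 1) powr x)
      = (\<lambda>x. (sqrt pi * (x / exp 1) powr x) * sqrt (2 * x))"
    by (simp add: real_sqrt_mult mult_ac)
  ultimately show ?thesis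
    unfolding p_def using asymp_equiv_trans[OF Gamma_stirling_asymp_equiv] by simp
qed

end
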